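(* If $G$ is a unit circular-arc graph with no maximal independent set of size less than $4$, then $G$ is a $2$-dot product graph.
   Context: Graphs are finite and simple. A unit circular-arc graph is the intersection graph of a finite collection of unit-length (i.e. equal-length, closed) arcs of a circle: the vertices are the arcs, and two distinct vertices are adjacent if and only if the corresponding arcs intersect. "Maximal" means inclusion-maximal. A graph $G=(V,E)$ is a $2$-dot product graph if there are vectors $\mathbf{a}^u\in\mathbb{R}^2$ ($u\in V$) and a threshold $t>0$ such that, for all distinct $u,v\in V$, $uv\in E$ if and only if $\mathbf{a}^u\cdot\mathbf{a}^v\ge t$ (one may take $t=1$ by scaling). *)

theory Defs
  imports "HOL-Complex_Analysis.Complex_Analysis" "Graph_Theory.Pair_Digraph"
begin

text \<open>
  Finite simple graphs are the symmetric, loop-free, finite pair digraphs \<^locale>\<open>pair_graph\<close>;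
  vertices \<open>u\<close> and \<open>v\<close> are adjacent iff \<open>(u, v) \<in> parcs G\<close>.
\<close>

definition independent_set :: "'a pair_pre_digraph \<Rightarrow> 'a set \<Rightarrow> bool" where
  "independent_set G S \<longleftrightarrow> S \<subseteq> pverts G \<and> (\<forall>u\<in>S. \<forall>v\<in>S. (u, v) \<notin> parcs G)"

definition maximal_independent_set :: "'a pair_pre_digraph \<Rightarrow> 'a set \<Rightarrow> bool" where
  "maximal_independent_set G S \<longleftrightarrow>
     independent_set G S \<and> (\<forall>T. independent_set G T \<and> S \<subseteq> T \<longrightarrow> T = S)"

text \<open>
  The closed arc of length \<open>1\<close> that starts at angle \<open>\<theta>\<close> on the circle in the complex plane with
  centre \<open>z\<close> and radius \<open>r\<close>; it sweeps an angle of \<open>1 / r\<close>.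
\<close>

definition unit_arc :: "complex \<Rightarrow> real \<Rightarrow> real \<Rightarrow> complex set" where
  "unit_arc z r \<theta> = path_image (part_circlepath z r \<theta> (\<theta> + 1 / r))"

text \<open>
  The circumference \<open>2 * pi * r\<close> exceeds \<open>1\<close>, so that a unit arc does not wrap around the circle.
  Equal arcs may be assigned to different vertices.
\<close>

definition unit_circular_arc_graph :: "'a pair_pre_digraph \<Rightarrow> bool" where
  "unit_circular_arc_graph G \<longleftrightarrow>
     pair_graph G \<and>
     (\<exists>z r \<theta>. 2 * pi * r > 1 \<and>
        (\<forall>u\<in>pverts G. \<forall>v\<in>pverts G. u \<noteq> v \<longrightarrow>
           ((u, v) \<in> parcs G \<longleftrightarrow> unit_arc z r (\<theta> u) \<inter> unit_arc z r (\<theta> v) \<noteq> {})))"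

definition two_dot_product_graph :: "'a pair_pre_digraph \<Rightarrow> bool" where
  "two_dot_product_graph G \<longleftrightarrow>
     pair_graph G \<and>
     (\<exists>(a :: 'a \<Rightarrow> real ^ 2) t. t > 0 \<and>
        (\<forall>u\<in>pverts G. \<forall>v\<in>pverts G. u \<noteq> v \<longrightarrow>
           ((u, v) \<in> parcs G \<longleftrightarrow> a u \<bullet> a v \<ge> t)))"

end

theory Submission
  imports Defs
begin

text \<open>
  Arcs sweeping an angle \<open>w \<le> pi\<close> that start at \<open>\<alpha>\<close> and \<open>\<beta>\<close> intersect iff
  \<open>cos (\<alpha> - \<beta>) \<ge> cos w\<close>, so the unit vectors at the starting angles represent the graph with
  threshold \<open>cos w\<close>, as soon as \<open>w < pi / 2\<close>. Otherwise \<open>cos w \<le> 0\<close> (or all arcs intersect), and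
  four independent vertices would give four plane vectors with pairwise negative inner products.
\<close>

lemma exists_int_multiple_2pi_near: "\<exists>k::int. \<bar>x - 2 * pi * k\<bar> \<le> pi"
proof
  have "\<bar>of_int (round (x / (2 * pi))) - x / (2 * pi)\<bar> \<le> 1 / 2"
    by (rule of_int_round_abs_le)
  then show "\<bar>x - 2 * pi * round (x / (2 * pi))\<bar> \<le> pi"
    by (simp add: abs_le_iff field_simps)
qed

lemma cos_minus_2pi_int: "cos (x - 2 * pi * of_int k) = cos (x::real)"
  by (simp add: cos_diff)

text \<open>Cosine is even and 2 pi periodic, so x may be replaced by the absolute value of its
  representative nearest 0. That value and \<open>w\<close> both lie between 0 and pi, where cosine
  is strictly decreasing.\<close>

lemma cos_ge_cos_iff_near_2pi_multiple:
  fixes x w :: real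
  assumes "0 \<le> w" "w \<le> pi"
  shows "cos w \<le> cos x \<longleftrightarrow> (\<exists>k::int. \<bar>x - 2 * pi * k\<bar> \<le> w)"
proof
  assume ge: "cos w \<le> cos x"
  obtain k :: int where k: "\<bar>x - 2 * pi * k\<bar> \<le> pi"
    using exists_int_multiple_2pi_near by blast
  have "cos w \<le> cos \<bar>x - 2 * pi * k\<bar>"
    using ge by (simp only: cos_abs_real cos_minus_2pi_int)
  then have "\<bar>x - 2 * pi * k\<bar> \<le> w"
    using assms k by (subst (asm) cos_mono_le_eq) auto
  then show "\<exists>k::int. \<bar>x - 2 * pi * k\<bar> \<le> w" ..
next
  assume "\<exists>k::int. \<bar>x - 2 * pi * k\<bar> \<le> w"
  then obtain k :: int where "\<bar>x - 2 * pi * k\<bar> \<le> w" ..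
  then have "cos w \<le> cos \<bar>x - 2 * pi * k\<bar>"
    using assms by (intro cos_monotone_0_pi_le) auto
  then show "cos w \<le> cos x"
    by (simp only: cos_abs_real cos_minus_2pi_int)
qed

lemma unit_arc_eq_image:
  assumes "r > 0"
  shows "unit_arc z r \<alpha> = (\<lambda>x. z + r * cis x) ` {\<alpha>..\<alpha> + 1 / r}"
  using assms
  by (simp add: unit_arc_def path_image_part_circlepath' closed_segment_eq_real_ivl cis_conv_exp)

text \<open>Unrolling the circle onto the line turns arcs into intervals of length
  \<open>1 / r\<close>, determined up to shifts by multiples of 2 pi. Two closed intervals of equal
  length meet iff their left endpoints differ by at most that length.\<close>

lemma unit_arcs_intersect_iff:
  assumes "r > 0"
  shows "unit_arc z r \<alpha> \<inter> unit_arc z r \<beta> \<noteq> {} \<longleftrightarrow>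
    (\<exists>k::int. \<bar>\<alpha> - \<beta> - 2 * pi * k\<bar> \<le> 1 / r)"
proof
  assume "unit_arc z r \<alpha> \<inter> unit_arc z r \<beta> \<noteq> {}"
  then obtain x y where x: "x \<in> {\<alpha>..\<alpha> + 1 / r}" and y: "y \<in> {\<beta>..\<beta> + 1 / r}"
    and "z + r * cis x = z + r * cis y"
    unfolding unit_arc_eq_image[OF assms] by blast
  then have "cis x = cis y"
    using assms by simp
  then obtain k :: int where "x = y + 2 * pi * k"
    using sin_cos_eq_iff[of x y] by (auto simp: complex_eq_iff)
  then have "\<bar>\<alpha> - \<beta> - 2 * pi * k\<bar> \<le> 1 / r"
    using x y by auto
  then show "\<exists>k::int. \<bar>\<alpha> - \<beta> - 2 * pi * k\<bar> \<le> 1 / r" ..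
next
  assume "\<exists>k::int. \<bar>\<alpha> - \<beta> - 2 * pi * k\<bar> \<le> 1 / r"
  then obtain k :: int where k: "\<bar>\<alpha> - \<beta> - 2 * pi * k\<bar> \<le> 1 / r" ..
  \<comment> \<open>The later of the two starting angles, once \<beta> has been shifted by k full
    turns, lies in both lifted intervals.\<close>
  define x where "x = max \<alpha> (\<beta> + 2 * pi * k)"
  have "x \<in> {\<alpha>..\<alpha> + 1 / r}" "x - 2 * pi * k \<in> {\<beta>..\<beta> + 1 / r}"
    using k assms by (auto simp: x_def max_def)
  moreover have "cis x = cis (x - 2 * pi * k)"
    by (simp add: complex_eq_iff cos_diff sin_diff)
  ultimately have "z + r * cis x \<in> unit_arc z r \<alpha> \<inter> unit_arc z r \<beta>"
    unfolding unit_arc_eq_image[OF assms] by (metis (no_types, lifting) IntI image_eqI)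
  then show "unit_arc z r \<alpha> \<inter> unit_arc z r \<beta> \<noteq> {}"
    by blast
qed

lemma not_four_pairwise_obtuse:
  fixes a b c d :: real
  assumes "cos (b - a) < 0" "cos (c - a) < 0" "cos (d - a) < 0"
    and "cos (b - c) < 0" "cos (b - d) < 0" "cos (c - d) < 0"
  shows False
proof -
  \<comment> \<open>With \<open>a\<close> as reference direction, two of the other three lie in a common closed quadrant.\<close>
  have opposite: "sin (x - a) * sin (y - a) < 0"
    if "cos (x - a) < 0" "cos (y - a) < 0" "cos (x - y) < 0" for x y
  proof -
    have "cos (x - y) = cos (x - a) * cos (y - a) + sin (x - a) * sin (y - a)"
      using cos_diff[of "x - a" "y - a"] by simp
    moreover have "cos (x - a) * cos (y - a) > 0"
      using that by (simp add: mult_neg_neg)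
    ultimately show ?thesis
      using that by linarith
  qed
  \<comment> \<open>The sines of \<open>b - a\<close>, \<open>c - a\<close> and \<open>d - a\<close>
    would have pairwise opposite signs, which is impossible for three reals.\<close>
  show False
    using opposite[of b c] opposite[of b d] opposite[of c d] assms
    by (auto simp: mult_less_0_iff)
qed

text \<open>Needed to exploit the hypothesis of the theorem, which bounds the size of maximal
  independent sets without asserting that one exists. The independent sets form a finite family that
  contains the empty set.\<close>

lemma exists_maximal_independent_set:
  assumes "finite (pverts G)"
  shows "\<exists>S. maximal_independent_set G S"
proof -
  have "{S. independent_set G S} \<subseteq> Pow (pverts G)"
    by (auto simp: independent_set_def)
  then have "finite {S. independent_set G S}"
    using assms by (meson finite_Pow_iff finite_subset)
  moreover have "{} \<in> {S. independent_set G S}"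
    by (simp add: independent_set_def)
  ultimately obtain S where "independent_set G S"
    "\<And>T. independent_set G T \<Longrightarrow> S \<subseteq> T \<Longrightarrow> S = T"
    using finite_has_maximal[of "{S. independent_set G S}"] by blast
  then show ?thesis
    by (auto simp: maximal_independent_set_def)
qed

theorem theorem11:
  fixes G :: "'a pair_pre_digraph"
  assumes "unit_circular_arc_graph G"
    and "\<not> (\<exists>S. maximal_independent_set G S \<and> card S < 4)"
  shows "two_dot_product_graph G"
proof -
  obtain z r \<theta> where G: "pair_graph G" and r: "2 * pi * r > 1"
    and arcs: "\<And>u v. u \<in> pverts G \<Longrightarrow> v \<in> pverts G \<Longrightarrow> u \<noteq> v \<Longrightarrow>
      (u, v) \<in> parcs G \<longleftrightarrow> unit_arc z r (\<theta> u) \<inter> unit_arc z r (\<theta> v) \<noteq> {}"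
    using assms(1) unfolding unit_circular_arc_graph_def by blast
  interpret pair_graph G by (rule G)
  have "r > 0"
    using r pi_gt_zero by (smt (verit) mult_nonneg_nonpos)
  define w where "w = 1 / r"
  have "w > 0"
    using \<open>r > 0\<close> by (simp add: w_def)
  have adj_near: "(u, v) \<in> parcs G \<longleftrightarrow> (\<exists>k::int. \<bar>\<theta> u - \<theta> v - 2 * pi * k\<bar> \<le> w)"
    if "u \<in> pverts G" "v \<in> pverts G" "u \<noteq> v" for u v
    using arcs[OF that] unit_arcs_intersect_iff[OF \<open>r > 0\<close>] by (simp add: w_def)
  obtain S where S: "maximal_independent_set G S"
    using exists_maximal_independent_set[OF pair_finite_verts] by blast
  with assms(2) have "4 \<le> card S"
    by force
  then obtain T where "T \<subseteq> S" "card T = 4"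
    by (meson obtain_subset_with_card_n)
  moreover from this obtain a b c d where "T = {a, b, c, d}"
    by (auto simp: card_Suc_eq numeral_eq_Suc)
  ultimately have T: "{a, b, c, d} \<subseteq> S" and
    distinct: "a \<noteq> b" "a \<noteq> c" "a \<noteq> d" "b \<noteq> c" "b \<noteq> d" "c \<noteq> d"
    by (auto simp: card_insert_if split: if_splits)
  have verts: "x \<in> pverts G" and nonadj: "(x, y) \<notin> parcs G" if "x \<in> S" "y \<in> S" for x y
    using S that by (auto simp: maximal_independent_set_def independent_set_def)
  \<comment> \<open>Any two directions are at most pi apart, so for larger \<open>w\<close> all arcs
    would meet, yet \<open>a\<close> and \<open>b\<close> are nonadjacent.\<close>
  have "w \<le> pi"
  proof (rule ccontr)
    assume "\<not> w \<le> pi"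
    moreover obtain k :: int where "\<bar>\<theta> a - \<theta> b - 2 * pi * k\<bar> \<le> pi"
      using exists_int_multiple_2pi_near by blast
    ultimately have "\<bar>\<theta> a - \<theta> b - 2 * pi * k\<bar> \<le> w"
      by linarith
    then show False
      using adj_near[of a b] nonadj[of a b] verts T distinct by auto
  qed
  then have adj_cos: "(u, v) \<in> parcs G \<longleftrightarrow> cos w \<le> cos (\<theta> u - \<theta> v)"
    if "u \<in> pverts G" "v \<in> pverts G" "u \<noteq> v" for u v
    using adj_near[OF that] cos_ge_cos_iff_near_2pi_multiple[of w] \<open>w > 0\<close> by simp
  \<comment> \<open>The threshold of a dot product representation has to be positive. If it were
    not, nonadjacency in \<open>S\<close> would force cosines below \<open>cos w\<close>, hence
    negative, for all pairs among the four vertices.\<close>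
  have "cos w > 0"
  proof (rule ccontr)
    assume "\<not> cos w > 0"
    then have obtuse: "cos (\<theta> u - \<theta> v) < 0" if "u \<in> S" "v \<in> S" "u \<noteq> v" for u v
      using adj_cos[of u v] nonadj[of u v] verts that by force
    show False
      by (rule not_four_pairwise_obtuse[of "\<theta> b" "\<theta> a" "\<theta> c" "\<theta> d"]; rule obtuse)
        (use T distinct in auto)
  qed
  moreover have "(vector [cos \<alpha>, sin \<alpha>] :: real ^ 2) \<bullet> vector [cos \<beta>, sin \<beta>] = cos (\<alpha> - \<beta>)"
    for \<alpha> \<beta>
    by (simp add: inner_vec_def sum_2 cos_diff)
  ultimately show ?thesis
    unfolding two_dot_product_graph_def using G adj_cos
    by (intro conjI exI[of _ "\<lambda>u. vector [cos (\<theta> u), sin (\<theta> u)]"] exI[of _ "cos w"]) auto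
qed

end
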